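(* The function $f$, defined on the positive integers, is strictly increasing.
   Context: For a positive integer $n$, let $E_n=\{x_i=1,\ x_i+x_j=x_k,\ x_i\cdot x_j=x_k : i,j,k\in\{1,\ldots,n\}\}$, a finite set of equations in the variables $x_1,\ldots,x_n$ (the indices $i,j,k$ need not be distinct). A subsystem of $E_n$ is a subset $S\subseteq E_n$; its solutions are the tuples $(x_1,\ldots,x_n)\in\mathbb{Z}^n$ satisfying all equations in $S$. For a positive integer $n$, $f(n)$ denotes the greatest finite total number of solutions of a subsystem of $E_n$ in integers $x_1,\ldots,x_n$, i.e. the maximum of the number of integer solutions over all subsystems $S\subseteq E_n$ that have only finitely many integer solutions. *)

theory Defs
  imports "HOL-Library.FuncSet"
begin

(* Equations over variables named by their index:
   x_i = 1,  x_i + x_j = x_k,  x_i * x_j = x_k. *)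
datatype equation =
    UnitEq nat
  | SumEq nat nat nat
  | ProductEq nat nat nat

definition E_sys :: "nat \<Rightarrow> equation set" where
  "E_sys n = {UnitEq i | i. i \<in> {1..n}}
       \<union> {SumEq i j k | i j k. i \<in> {1..n} \<and> j \<in> {1..n} \<and> k \<in> {1..n}}
       \<union> {ProductEq i j k | i j k. i \<in> {1..n} \<and> j \<in> {1..n} \<and> k \<in> {1..n}}"

fun satisfies :: "(nat \<Rightarrow> int) \<Rightarrow> equation \<Rightarrow> bool" where
  "satisfies x (UnitEq i) \<longleftrightarrow> x i = 1"
| "satisfies x (SumEq i j k) \<longleftrightarrow> x i + x j = x k"
| "satisfies x (ProductEq i j k) \<longleftrightarrow> x i * x j = x k"

(* Integer n-tuples are extensional functions on {1..n}, so that distinct functions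
   are distinct tuples and cardinalities are those of subsets of Z^n. *)
definition solutions :: "nat \<Rightarrow> equation set \<Rightarrow> (nat \<Rightarrow> int) set" where
  "solutions n S = {x \<in> {1..n} \<rightarrow>\<^sub>E (UNIV :: int set). \<forall>e\<in>S. satisfies x e}"

definition finite_solution_counts :: "nat \<Rightarrow> nat set" where
  "finite_solution_counts n =
     {card (solutions n S) | S. S \<subseteq> E_sys n \<and> finite (solutions n S)}"

definition greatest_finite_count :: "nat \<Rightarrow> nat" where
  "greatest_finite_count n = Max (finite_solution_counts n)"

(* The maximum defining greatest_finite_count is taken over a finite nonempty set. *)

lemma finite_E_sys: "finite (E_sys n)"
proof (rule finite_subset)
  let ?I = "{1..n}"
  let ?T = "?I \<times> ?I \<times> ?I"
  show "E_sys n \<subseteq> UnitEq ` ?I \<union> (\<lambda>(i, j, k). SumEq i j k) ` ?T \<union> (\<lambda>(i, j, k). ProductEq i j k) ` ?T"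
  proof
    fix e assume e: "e \<in> E_sys n"
    show "e \<in> UnitEq ` ?I \<union> (\<lambda>(i, j, k). SumEq i j k) ` ?T \<union> (\<lambda>(i, j, k). ProductEq i j k) ` ?T"
      using e by (cases e) (simp_all add: E_sys_def image_iff)
  qed
  show "finite (UnitEq ` ?I \<union> (\<lambda>(i, j, k). SumEq i j k) ` ?T \<union> (\<lambda>(i, j, k). ProductEq i j k) ` ?T)"
    by (intro finite_UnI finite_imageI finite_cartesian_product finite_atLeastAtMost)
qed

lemma finite_finite_solution_counts: "finite (finite_solution_counts n)"
proof -
  have "finite_solution_counts n \<subseteq> (\<lambda>S. card (solutions n S)) ` Pow (E_sys n)"
    unfolding finite_solution_counts_def by blast
  then show ?thesis
    by (rule finite_subset) (simp add: finite_E_sys)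
qed

lemma finite_solution_counts_nonempty:
  assumes "n \<ge> 1"
  shows "finite_solution_counts n \<noteq> {}"
proof -
  let ?S = "{UnitEq 1, SumEq 1 1 1}"
  have "?S \<subseteq> E_sys n"
    using assms by (auto simp: E_sys_def)
  moreover have "solutions n ?S = {}"
    by (auto simp: solutions_def)
  ultimately have "card (solutions n ?S) \<in> finite_solution_counts n"
    unfolding finite_solution_counts_def by (intro CollectI exI[of _ ?S]) simp
  then show ?thesis
    by blast
qed

end

(* A new variable subject only to y * y = y takes exactly the values 0 and 1, independently of
   the old variables, so adjoining it to an optimal system doubles the number of solutions:
   f (n + 1) \<ge> 2 f n > f n. *)
theory Submission
  imports Defs
begin

text \<open>Equations of \<open>E_sys n\<close> mention only indices in \<open>{1..n}\<close>, so a
  solution may be altered at coordinate \<open>Suc n\<close> without affecting them.\<close>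

lemma satisfies_cong:
  assumes "e \<in> E_sys n" "\<And>i. i \<in> {1..n} \<Longrightarrow> x i = y i"
  shows "satisfies x e \<longleftrightarrow> satisfies y e"
  using assms by (auto simp: E_sys_def)

lemma E_sys_Suc_mono: "E_sys n \<subseteq> E_sys (Suc n)"
proof
  fix e assume "e \<in> E_sys n"
  then show "e \<in> E_sys (Suc n)"
    by (cases e) (simp_all add: E_sys_def)
qed

lemma solutions_insert_idempotent:
  assumes "S \<subseteq> E_sys n"
  defines "m \<equiv> Suc n"
  shows "solutions m (insert (ProductEq m m m) S) = (\<lambda>(b, x). x(m := b)) ` ({0, 1} \<times> solutions n S)"
proof -
  have sat: "satisfies (x(m := b)) e \<longleftrightarrow> satisfies x e" if "e \<in> S" for x b e
    using assms that by (intro satisfies_cong[of e n]) auto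
  \<comment> \<open>Split each tuple into its last entry b and the remaining tuple x.\<close>
  have "{1..m} \<rightarrow>\<^sub>E (UNIV :: int set) = (\<lambda>(b, x). x(m := b)) ` (UNIV \<times> ({1..n} \<rightarrow>\<^sub>E UNIV))"
    unfolding m_def by (simp add: atLeastAtMostSuc_conv PiE_insert_eq)
  then have "solutions m (insert (ProductEq m m m) S) =
      {y \<in> (\<lambda>(b, x). x(m := b)) ` (UNIV \<times> ({1..n} \<rightarrow>\<^sub>E UNIV)).
        y m * y m = y m \<and> (\<forall>e\<in>S. satisfies y e)}"
    by (simp add: solutions_def)
  \<comment> \<open>Pulled back along this parametrisation, the constraints decouple: the new
    equation sees only b, and by \<open>sat\<close> the old ones see only x.\<close>
  also have "\<dots> = (\<lambda>(b, x). x(m := b)) ` {p \<in> UNIV \<times> ({1..n} \<rightarrow>\<^sub>E UNIV).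
        fst p * fst p = fst p \<and> (\<forall>e\<in>S. satisfies (snd p) e)}"
    by (simp add: Compr_image_eq case_prod_unfold sat cong: conj_cong)
  also have "\<dots> = (\<lambda>(b, x). x(m := b)) ` ({0, 1} \<times> solutions n S)"
    \<comment> \<open>The only idempotent integers are 0 and 1.\<close>
    by (rule arg_cong[where f = "image _"]) (auto simp: solutions_def)
  finally show ?thesis .
qed

lemma double_mem_finite_solution_counts:
  assumes "c \<in> finite_solution_counts n"
  shows "2 * c \<in> finite_solution_counts (Suc n)"
proof -
  let ?m = "Suc n"
  from assms obtain S where S: "S \<subseteq> E_sys n" "finite (solutions n S)" "c = card (solutions n S)"
    by (auto simp: finite_solution_counts_def)
  let ?S = "insert (ProductEq ?m ?m ?m) S"
  \<comment> \<open>Extensionality is essential: x is \<open>undefined\<close> at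
    \<open>Suc n\<close>, so overwriting that value loses no information and x can be
    recovered.\<close>
  have "inj_on (\<lambda>(b, x). x(?m := b)) (UNIV \<times> ({1..n} \<rightarrow>\<^sub>E (UNIV :: int set)))"
    by (rule inj_combinator) simp
  then have "inj_on (\<lambda>(b, x). x(?m := b)) ({0, 1} \<times> solutions n S)"
    by (rule inj_on_subset) (auto simp: solutions_def)
  then have "card (solutions ?m ?S) = 2 * c"
    by (simp add: solutions_insert_idempotent S card_image card_cartesian_product)
  moreover have "finite (solutions ?m ?S)"
    using S by (simp add: solutions_insert_idempotent)
  moreover have "?S \<subseteq> E_sys ?m"
    using order_trans[OF S(1) E_sys_Suc_mono] by (simp add: E_sys_def)
  ultimately show ?thesis
    unfolding finite_solution_counts_def by (intro CollectI exI[of _ ?S]) simp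
qed

text \<open>Fixing every variable to 1 leaves one tuple, the empty one if n = 0. This makes the set
  of counts nonempty and its maximum positive, which is what turns doubling into a strict
  increase.\<close>

lemma one_mem_finite_solution_counts: "1 \<in> finite_solution_counts n"
proof -
  let ?S = "UnitEq ` {1..n}"
  have "solutions n ?S = {1..n} \<rightarrow>\<^sub>E {1}"
    by (auto simp: solutions_def PiE_iff intro!: extensionalityI[of _ "{1..n}"])
  then have "card (solutions n ?S) = 1" "finite (solutions n ?S)"
    by (simp_all add: card_PiE finite_PiE)
  moreover have "?S \<subseteq> E_sys n"
    by (auto simp: E_sys_def)
  ultimately show ?thesis
    unfolding finite_solution_counts_def by (intro CollectI exI[of _ ?S]) simp
qed

lemma greatest_finite_count_Suc: "greatest_finite_count n < greatest_finite_count (Suc n)"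
proof -
  have "1 \<le> greatest_finite_count n"
    unfolding greatest_finite_count_def
    by (intro Max_ge finite_finite_solution_counts one_mem_finite_solution_counts)
  moreover have "greatest_finite_count n \<in> finite_solution_counts n"
    unfolding greatest_finite_count_def
    using one_mem_finite_solution_counts by (intro Max_in finite_finite_solution_counts) blast
  then have "2 * greatest_finite_count n \<le> greatest_finite_count (Suc n)"
    unfolding greatest_finite_count_def[of "Suc n"]
    by (intro Max_ge finite_finite_solution_counts double_mem_finite_solution_counts)
  ultimately show ?thesis
    by linarith
qed

theorem mainTheorem3:
  shows "strict_mono_on {1..} greatest_finite_count"
  \<comment> \<open>\<open>lift_Suc_mono_less\<close> needs the successor inequality at all
    naturals, 0 included.\<close>
  by (rule strict_mono_onI) (rule lift_Suc_mono_less[of greatest_finite_count, OF greatest_finite_count_Suc])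

end
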